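(* Let $\Gamma\subseteq\mathrm{Sym}(N)$ be a permutation group. A spherical arrangement is a $\Gamma$-arrangement if and only if its arrangement space is a $\Gamma$-invariant subspace of $\mathbb{R}^n$.
   Context: Let $n\ge 1$ and $N=\{1,\dots,n\}$. A ($d$-dimensional) arrangement is a family of points $v_i\in\mathbb{R}^d$, $i\in N$. Its matrix $M\in\mathbb{R}^{n\times d}$ has $i$-th row $v_i^\top$, and its arrangement space is the column span $U=\mathrm{span}\,M\subseteq\mathbb{R}^n$. An arrangement is spherical if $M^\top M=\alpha\,\mathrm{Id}$ for some $\alpha\in\mathbb{R}\setminus\{0\}$. For a permutation group $\Gamma\subseteq\mathrm{Sym}(N)$, an arrangement $v$ in $\mathbb{R}^d$ is a $\Gamma$-arrangement if there is a group homomorphism $T\colon\Gamma\to\mathrm{O}(\mathbb{R}^d)$ with $T_\phi v_i=v_{\phi(i)}$ for all $i\in N$, $\phi\in\Gamma$. The group $\Gamma$ acts on $\mathbb{R}^n$ by the permutation matrices $P_\phi$, where $P_\phi e_i=e_{\phi(i)}$ for the standard basis vectors $e_i$; a subspace $U\subseteq\mathbb{R}^n$ is $\Gamma$-invariant if $P_\phi U=U$ for all $\phi\in\Gamma$. *)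

theory Defs
  imports "HOL-Analysis.Analysis" "HOL-Algebra.Bij"
begin

text \<open>
  The index set \<open>N\<close> is the universe of a finite type \<open>'n\<close>, and the ambient space is
  \<open>real ^ 'd\<close>; since types are nonempty, both sizes are at least 1.
\<close>

definition arr_matrix :: "('n::finite \<Rightarrow> real ^ 'd::finite) \<Rightarrow> real ^ 'd ^ 'n" where
  "arr_matrix v = (\<chi> i. v i)"

definition arr_space :: "('n::finite \<Rightarrow> real ^ 'd::finite) \<Rightarrow> (real ^ 'n) set" where
  "arr_space v = span (columns (arr_matrix v))"

definition spherical :: "('n::finite \<Rightarrow> real ^ 'd::finite) \<Rightarrow> bool" where
  "spherical v \<longleftrightarrow>
     (\<exists>\<alpha>::real. \<alpha> \<noteq> 0 \<and> transpose (arr_matrix v) ** arr_matrix v = \<alpha> *\<^sub>R mat 1)"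

text \<open>
  On a whole type, \<open>BijGroup UNIV\<close> is the full symmetric group: every function is extensional
  on \<open>UNIV\<close>, and the multiplication is composition (see the two lemmas below).
\<close>

definition permutation_group :: "('n::finite \<Rightarrow> 'n) set \<Rightarrow> bool" where
  "permutation_group \<Gamma> \<longleftrightarrow> subgroup \<Gamma> (BijGroup UNIV)"

lemma carrier_BijGroup_UNIV: "carrier (BijGroup UNIV) = {\<phi>. bij \<phi>}"
  by (simp add: BijGroup_def Bij_def)

lemma mult_BijGroup_UNIV:
  "bij \<phi> \<Longrightarrow> bij \<psi> \<Longrightarrow> \<phi> \<otimes>\<^bsub>BijGroup UNIV\<^esub> \<psi> = \<phi> \<circ> \<psi>"
  by (auto simp: BijGroup_def Bij_def compose_def)

definition orthogonal_group :: "(real ^ 'd::finite \<Rightarrow> real ^ 'd) monoid" where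
  "orthogonal_group =
     \<lparr>carrier = {f. orthogonal_transformation f}, mult = (\<circ>), one = id\<rparr>"

lemma group_orthogonal_group: "group orthogonal_group"
proof (rule groupI)
  fix f :: "real ^ 'd \<Rightarrow> real ^ 'd"
  assume "f \<in> carrier orthogonal_group"
  then have f: "orthogonal_transformation f"
    by (simp add: orthogonal_group_def)
  then have "Hilbert_Choice.inv f \<circ> f = id"
    using orthogonal_transformation_inj inv_o_cancel by blast
  with f show "\<exists>g\<in>carrier orthogonal_group. g \<otimes>\<^bsub>orthogonal_group\<^esub> f = \<one>\<^bsub>orthogonal_group\<^esub>"
    by (auto simp: orthogonal_group_def intro: orthogonal_transformation_inv)
qed (auto simp: orthogonal_group_def orthogonal_transformation_compose id_def)

definition Gamma_arrangement ::
  "('n::finite \<Rightarrow> 'n) set \<Rightarrow> ('n \<Rightarrow> real ^ 'd::finite) \<Rightarrow> bool" where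
  "Gamma_arrangement \<Gamma> v \<longleftrightarrow>
     (\<exists>T \<in> hom ((BijGroup UNIV)\<lparr>carrier := \<Gamma>\<rparr>) orthogonal_group.
        \<forall>\<phi>\<in>\<Gamma>. \<forall>i. T \<phi> (v i) = v (\<phi> i))"

definition perm_matrix :: "('n::finite \<Rightarrow> 'n) \<Rightarrow> real ^ 'n ^ 'n" where
  "perm_matrix \<phi> = (\<chi> i j. if i = \<phi> j then 1 else 0)"

lemma perm_matrix_axis: "perm_matrix \<phi> *v axis i 1 = axis (\<phi> i) 1"
  unfolding matrix_vector_mult_basis
  by (simp add: perm_matrix_def column_def axis_def vec_eq_iff)

definition Gamma_invariant :: "('n::finite \<Rightarrow> 'n) set \<Rightarrow> (real ^ 'n) set \<Rightarrow> bool" where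
  "Gamma_invariant \<Gamma> U \<longleftrightarrow>
     subspace U \<and> (\<forall>\<phi>\<in>\<Gamma>. (\<lambda>x. perm_matrix \<phi> *v x) ` U = U)"

end

theory Submission
  imports Defs
begin

text \<open>
  Write \<open>M\<close> for the matrix of the arrangement and \<open>P\<^sub>\<phi>\<close> for the permutation matrix. The map
  \<open>x \<mapsto> M x\<close> has the arrangement space \<open>U\<close> as its range, and its \<open>i\<close>-th coordinate is
  \<open>v\<^sub>i \<bullet> x\<close>. Sphericity says that this map scales inner products by \<open>\<alpha>\<close>, so it is, up to
  scale, an isometry of \<open>\<real>\<^sup>d\<close> onto \<open>U\<close>.

  For an orthogonal \<open>T\<close>, the condition \<open>T v\<^sub>i = v\<^bsub>\<phi>(i)\<^esub>\<close> for all \<open>i\<close> is dual to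
  \<open>M \<circ> T = P\<^sub>\<phi> \<circ> M\<close> (lemma \<open>equivariant_iff_intertwines\<close>): \<open>T\<close> is the transport of \<open>P\<^sub>\<phi>\<close>
  from \<open>U\<close> to \<open>\<real>\<^sup>d\<close> along \<open>M\<close>. If such \<open>T\<close> exist, then \<open>P\<^sub>\<phi>\<close> maps \<open>U = M \<real>\<^sup>d\<close> onto
  \<open>M (T \<real>\<^sup>d) = U\<close>. Conversely, if \<open>U\<close> is invariant, then the restriction of \<open>P\<^sub>\<phi>\<close> to \<open>U\<close>
  can be pulled back along \<open>M\<close>. The resulting \<open>T\<^sub>\<phi>\<close> is orthogonal because \<open>P\<^sub>\<phi>\<close> is an
  isometry and \<open>M\<close> is one up to scale, and \<open>\<phi> \<mapsto> T\<^sub>\<phi>\<close> is multiplicative because \<open>M\<close> is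
  injective.
\<close>

lemma arr_matrix_mult_nth: "(arr_matrix v *v x) $ i = v i \<bullet> x"
  by (simp add: arr_matrix_def matrix_vector_mult_def inner_vec_def)

lemma arr_space_eq_range: "arr_space v = range (\<lambda>x. arr_matrix v *v x)"
proof
  show "range (\<lambda>x. arr_matrix v *v x) \<subseteq> arr_space v"
    by (auto simp: arr_space_def matrix_vector_mult_in_columnspace)
  have "columns (arr_matrix v) \<subseteq> range (\<lambda>x. arr_matrix v *v x)"
    by (auto simp: columns_image_basis)
  moreover have "subspace (range (\<lambda>x. arr_matrix v *v x))"
    by (simp add: linear_subspace_image)
  ultimately show "arr_space v \<subseteq> range (\<lambda>x. arr_matrix v *v x)"
    unfolding arr_space_def by (rule span_minimal)
qed

lemma permutation_group_bij: "permutation_group \<Gamma> \<Longrightarrow> \<phi> \<in> \<Gamma> \<Longrightarrow> bij \<phi>"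
  unfolding permutation_group_def using subgroup.subset carrier_BijGroup_UNIV by blast

lemma perm_matrix_mult_nth:
  assumes "bij \<phi>"
  shows "(perm_matrix \<phi> *v y) $ \<phi> i = y $ i"
  using assms
  by (simp add: perm_matrix_def matrix_vector_mult_def bij_is_inj inj_eq
      if_distrib[of "\<lambda>c. c * _"] cong: if_cong)

lemma perm_matrix_mult_eqI:
  assumes "bij \<phi>" and "\<And>i. z $ \<phi> i = y $ i"
  shows "perm_matrix \<phi> *v y = z"
  unfolding vec_eq_iff
  by (metis assms perm_matrix_mult_nth bij_pointE)

lemma perm_matrix_comp:
  assumes "bij \<phi>" and "bij \<psi>"
  shows "perm_matrix (\<phi> \<circ> \<psi>) *v y = perm_matrix \<phi> *v (perm_matrix \<psi> *v y)"
  by (intro perm_matrix_mult_eqI) (use assms in \<open>auto simp: perm_matrix_mult_nth bij_comp\<close>)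

lemma inner_perm_matrix:
  assumes "bij \<phi>"
  shows "(perm_matrix \<phi> *v x) \<bullet> (perm_matrix \<phi> *v y) = x \<bullet> y"
  unfolding inner_vec_def
  by (subst sum.reindex_bij_betw[OF assms, symmetric]) (simp add: perm_matrix_mult_nth assms)

lemma spherical_scales_inner:
  assumes "spherical v"
  obtains \<alpha> where "\<alpha> \<noteq> 0"
    and "\<And>x y. (arr_matrix v *v x) \<bullet> (arr_matrix v *v y) = \<alpha> * (x \<bullet> y)"
proof -
  obtain \<alpha> where "\<alpha> \<noteq> 0" and \<alpha>: "transpose (arr_matrix v) ** arr_matrix v = \<alpha> *\<^sub>R mat 1"
    using assms unfolding spherical_def by blast
  have "(arr_matrix v *v x) \<bullet> (arr_matrix v *v y) = \<alpha> * (x \<bullet> y)" for x y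
  proof -
    have "(arr_matrix v *v x) \<bullet> (arr_matrix v *v y)
        = x \<bullet> ((transpose (arr_matrix v) ** arr_matrix v) *v y)"
      using dot_lmul_matrix[of x "transpose (arr_matrix v)" "arr_matrix v *v y"]
      by (simp add: matrix_vector_mul_assoc del: transpose_matrix_vector)
    then show ?thesis
      by (simp add: \<alpha> scaleR_matrix_vector_assoc[symmetric])
  qed
  with \<open>\<alpha> \<noteq> 0\<close> show thesis by (rule that)
qed

lemma inj_arr_matrix:
  assumes "spherical v"
  shows "inj (\<lambda>x. arr_matrix v *v x)"
proof (rule injI)
  fix x y
  assume "arr_matrix v *v x = arr_matrix v *v y"
  then have "arr_matrix v *v (x - y) = 0"
    by (simp add: matrix_vector_mult_diff_distrib)
  then show "x = y"
    by (metis assms spherical_scales_inner inner_eq_zero_iff inner_zero_left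
        mult_eq_0_iff right_minus_eq)
qed

text \<open>
  The \<open>\<phi>(i)\<close>-th coordinates of \<open>M (T x)\<close> and \<open>P\<^sub>\<phi> (M x)\<close> are \<open>v\<^bsub>\<phi>(i)\<^esub> \<bullet> T x\<close> and
  \<open>v\<^sub>i \<bullet> x = T v\<^sub>i \<bullet> T x\<close>. Since \<open>T\<close> is onto, they agree for all \<open>x\<close> exactly when
  \<open>v\<^bsub>\<phi>(i)\<^esub> = T v\<^sub>i\<close>.
\<close>

lemma equivariant_iff_intertwines:
  assumes "bij \<phi>" and T: "orthogonal_transformation T"
  shows "(\<forall>i. T (v i) = v (\<phi> i))
    \<longleftrightarrow> (\<forall>x. arr_matrix v *v T x = perm_matrix \<phi> *v (arr_matrix v *v x))"
proof
  assume *: "\<forall>i. T (v i) = v (\<phi> i)"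
  have "v (\<phi> i) \<bullet> T x = v i \<bullet> x" for i x
    using T * by (metis orthogonal_transformation_def)
  then show "\<forall>x. arr_matrix v *v T x = perm_matrix \<phi> *v (arr_matrix v *v x)"
    using perm_matrix_mult_eqI[OF \<open>bij \<phi>\<close>] by (metis arr_matrix_mult_nth)
next
  assume *: "\<forall>x. arr_matrix v *v T x = perm_matrix \<phi> *v (arr_matrix v *v x)"
  show "\<forall>i. T (v i) = v (\<phi> i)"
  proof
    fix i
    have "T (v i) \<bullet> T x = v (\<phi> i) \<bullet> T x" for x
      using T * by (metis orthogonal_transformation_def arr_matrix_mult_nth
          perm_matrix_mult_nth \<open>bij \<phi>\<close>)
    then have "T (v i) \<bullet> y = v (\<phi> i) \<bullet> y" for y
      using orthogonal_transformation_surj[OF T] by (metis surjD)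
    then show "T (v i) = v (\<phi> i)"
      using vector_eq_rdot by blast
  qed
qed

lemma Gamma_arrangement_imp_invariant:
  assumes "permutation_group \<Gamma>" and "Gamma_arrangement \<Gamma> v"
  shows "Gamma_invariant \<Gamma> (arr_space v)"
  unfolding Gamma_invariant_def
proof (intro conjI ballI)
  show "subspace (arr_space v)"
    by (simp add: arr_space_def)
  fix \<phi> assume "\<phi> \<in> \<Gamma>"
  then obtain T where T: "orthogonal_transformation T" and v: "\<forall>i. T (v i) = v (\<phi> i)"
    using assms(2) unfolding Gamma_arrangement_def
    by (fastforce simp: hom_def orthogonal_group_def)
  have "\<And>x. perm_matrix \<phi> *v (arr_matrix v *v x) = arr_matrix v *v T x"
    using equivariant_iff_intertwines[OF permutation_group_bij[OF assms(1) \<open>\<phi> \<in> \<Gamma>\<close>] T] v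
    by metis
  then have "(\<lambda>x. perm_matrix \<phi> *v x) ` arr_space v = (\<lambda>x. arr_matrix v *v x) ` range T"
    by (simp add: arr_space_eq_range image_image)
  then show "(\<lambda>x. perm_matrix \<phi> *v x) ` arr_space v = arr_space v"
    using orthogonal_transformation_surj[OF T] by (simp add: arr_space_eq_range)
qed

text \<open>
  Any \<open>T\<close> that transports \<open>P\<^sub>\<phi>\<close> along the scaled isometry \<open>M\<close> preserves inner products:
  \<open>\<alpha> (T x \<bullet> T y) = M (T x) \<bullet> M (T y) = P\<^sub>\<phi> (M x) \<bullet> P\<^sub>\<phi> (M y) = M x \<bullet> M y = \<alpha> (x \<bullet> y)\<close>.
  Linearity is inherited through the injectivity of \<open>M\<close>.
\<close>

lemma intertwining_imp_orthogonal:
  assumes "spherical v" and "bij \<phi>"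
    and T: "\<And>x. arr_matrix v *v T x = perm_matrix \<phi> *v (arr_matrix v *v x)"
  shows "orthogonal_transformation T"
  unfolding orthogonal_transformation_def
proof (intro conjI allI)
  show "linear T"
    by (rule linearI; rule injD[OF inj_arr_matrix[OF assms(1)]])
      (simp_all add: T matrix_vector_right_distrib matrix_vector_mult_scaleR)
  fix x y
  show "T x \<bullet> T y = x \<bullet> y"
    using spherical_scales_inner[OF assms(1)]
    by (metis T inner_perm_matrix[OF assms(2)] mult_left_cancel)
qed

lemma invariant_imp_Gamma_arrangement:
  assumes \<Gamma>: "permutation_group \<Gamma>" and v: "spherical v"
    and inv: "Gamma_invariant \<Gamma> (arr_space v)"
  shows "Gamma_arrangement \<Gamma> v"
proof -
  note bij = permutation_group_bij[OF \<Gamma>]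
  have "\<exists>y. arr_matrix v *v y = perm_matrix \<phi> *v (arr_matrix v *v x)" if "\<phi> \<in> \<Gamma>" for \<phi> x
  proof -
    have "perm_matrix \<phi> *v (arr_matrix v *v x) \<in> arr_space v"
      using inv that unfolding Gamma_invariant_def arr_space_eq_range by blast
    then show ?thesis
      by (auto simp: arr_space_eq_range)
  qed
  then obtain T where
    T: "\<And>\<phi> x. \<phi> \<in> \<Gamma> \<Longrightarrow> arr_matrix v *v T \<phi> x = perm_matrix \<phi> *v (arr_matrix v *v x)"
    by metis
  have orth: "orthogonal_transformation (T \<phi>)" if "\<phi> \<in> \<Gamma>" for \<phi>
    using intertwining_imp_orthogonal[OF v bij[OF that]] T[OF that] by blast
  have mult: "T (\<phi> \<circ> \<psi>) = T \<phi> \<circ> T \<psi>" if "\<phi> \<in> \<Gamma>" "\<psi> \<in> \<Gamma>" for \<phi> \<psi>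
  proof
    fix x
    have "\<phi> \<circ> \<psi> \<in> \<Gamma>"
      using \<Gamma> that unfolding permutation_group_def
      by (metis subgroup.m_closed mult_BijGroup_UNIV bij)
    then have "arr_matrix v *v T (\<phi> \<circ> \<psi>) x = arr_matrix v *v (T \<phi> \<circ> T \<psi>) x"
      by (simp add: T that perm_matrix_comp bij)
    then show "T (\<phi> \<circ> \<psi>) x = (T \<phi> \<circ> T \<psi>) x"
      using inj_arr_matrix[OF v] by (rule injD[rotated])
  qed
  have "T \<in> hom ((BijGroup UNIV)\<lparr>carrier := \<Gamma>\<rparr>) orthogonal_group"
    by (auto simp: hom_def orthogonal_group_def orth mult mult_BijGroup_UNIV bij)
  moreover have "\<forall>\<phi>\<in>\<Gamma>. \<forall>i. T \<phi> (v i) = v (\<phi> i)"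
    using equivariant_iff_intertwines bij orth T by blast
  ultimately show ?thesis
    unfolding Gamma_arrangement_def by blast
qed

theorem corollary4p10:
  fixes \<Gamma> :: "('n::finite \<Rightarrow> 'n) set"
    and v :: "'n \<Rightarrow> real ^ 'd::finite"
  assumes "permutation_group \<Gamma>"
    and "spherical v"
  shows "Gamma_arrangement \<Gamma> v \<longleftrightarrow> Gamma_invariant \<Gamma> (arr_space v)"
  using assms Gamma_arrangement_imp_invariant invariant_imp_Gamma_arrangement by blast

end
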